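(* Let $P$ be a $\Sigma$-pattern with first symbol in $\Sigma$, of length $r$ and with exactly one gap (i.e. $\mathrm{T}(P)$ is a Toeplitz word of type $(r,1)$). Then for all positive integers $a,b$, the arithmetic subsequence $\mathrm{T}(P)_{a,b}$ is a Toeplitz word, i.e. there is a $\Sigma$-pattern $Q$ with first symbol in $\Sigma$ such that $\mathrm{T}(P)_{a,b}=\mathrm{T}(Q)$.
   Context: $\Sigma$ is a fixed finite cyclic group, $\mathrm{S}_\Sigma$ the group of bijections of $\Sigma$ (assumed disjoint from $\Sigma$), whose elements are called gaps. A $\Sigma$-pattern is a nonempty finite word over $\Sigma\cup\mathrm{S}_\Sigma$. For words $x,y$ over $\Sigma\cup\mathrm{S}_\Sigma$, $x\langle y\rangle$ fills the gaps of $x$ in order by the letters of $y$: $(a\,x)\langle y\rangle=a\,x\langle y\rangle$, $(f\,x)\langle b\,y\rangle=f(b)\,x\langle y\rangle$, $(f\,x)\langle g\,y\rangle=(f\circ g)\,x\langle y\rangle$ ($a,b\in\Sigma$, $f,g\in\mathrm{S}_\Sigma$). For a pattern $P$ whose first symbol is in $\Sigma$, let $T_0=?^\omega$ ($?$ the identity bijection), $T_{i+1}=P^\omega\langle T_i\rangle$; the Toeplitz word generated by $P$ is $\mathrm{T}(P)=\lim_i T_i$, an infinite word over $\Sigma$ indexed by positive integers. For a sequence $\sigma$ indexed by positive integers and $a,b\ge1$, $\sigma_{a,b}(n)=\sigma(a+b(n-1))$ for $n\ge1$. *)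

theory Defs
  imports "HOL-Algebra.Algebra" "HOL-Library.Stream"
begin

text \<open>
  The alphabet is a set \<open>S\<close> (in the theorem: the carrier of a finite cyclic group). Gaps are the
  elements of \<open>BijGroup S\<close>; \<open>Inl\<close> and \<open>Inr\<close> make letters and gaps disjoint.
\<close>

type_synonym 'a symb = "'a + ('a \<Rightarrow> 'a)"

definition symbols :: "'a set \<Rightarrow> 'a symb set"
  where "symbols S = Inl ` S \<union> Inr ` carrier (BijGroup S)"

definition is_pattern :: "'a set \<Rightarrow> 'a symb list \<Rightarrow> bool"
  where "is_pattern S P \<longleftrightarrow> P \<noteq> [] \<and> set P \<subseteq> symbols S"

definition starts_with_letter :: "'a symb list \<Rightarrow> bool"
  where "starts_with_letter P \<longleftrightarrow> P \<noteq> [] \<and> isl (hd P)"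

definition num_gaps :: "'a symb list \<Rightarrow> nat"
  where "num_gaps P = length (filter (\<lambda>s. \<not> isl s) P)"

fun fill_gap :: "'a set \<Rightarrow> ('a \<Rightarrow> 'a) \<Rightarrow> 'a symb \<Rightarrow> 'a symb"
  where
    "fill_gap S f (Inl b) = Inl (f b)"
  | "fill_gap S f (Inr g) = Inr (f \<otimes>\<^bsub>BijGroup S\<^esub> g)"

text \<open>
  The word \<open>x\<langle>y\<rangle>\<close>. Only infinite words \<open>x\<close>, \<open>y\<close> occur in the construction of Toeplitz words.
\<close>

primcorec fill :: "'a set \<Rightarrow> 'a symb stream \<Rightarrow> 'a symb stream \<Rightarrow> 'a symb stream"
  where
    "fill S x y =
      (case shd x of
         Inl a \<Rightarrow> Inl a ## fill S (stl x) y
       | Inr f \<Rightarrow> fill_gap S f (shd y) ## fill S (stl x) (stl y))"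

lemma fill_letter: "fill S (Inl a ## x) y = Inl a ## fill S x y"
  by (subst fill.code) simp

lemma fill_gap_letter: "fill S (Inr f ## x) (Inl b ## y) = Inl (f b) ## fill S x y"
  by (subst fill.code) simp

lemma fill_gap_gap:
  "fill S (Inr f ## x) (Inr g ## y) = Inr (f \<otimes>\<^bsub>BijGroup S\<^esub> g) ## fill S x y"
  by (subst fill.code) simp

primrec toeplitz_approx :: "'a set \<Rightarrow> 'a symb list \<Rightarrow> nat \<Rightarrow> 'a symb stream"
  where
    "toeplitz_approx S P 0 = sconst (Inr \<one>\<^bsub>BijGroup S\<^esub>)"
  | "toeplitz_approx S P (Suc i) = fill S (cycle P) (toeplitz_approx S P i)"

text \<open>
  Convergence of words is letterwise: every position is eventually constant. The limit is a word
  over the alphabet alone, without gaps.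
\<close>

definition is_toeplitz_limit :: "'a set \<Rightarrow> 'a symb list \<Rightarrow> 'a stream \<Rightarrow> bool"
  where "is_toeplitz_limit S P w \<longleftrightarrow>
    (\<forall>n. \<forall>\<^sub>F i in sequentially. toeplitz_approx S P i !! n = Inl (w !! n))"

definition toeplitz :: "'a set \<Rightarrow> 'a symb list \<Rightarrow> 'a stream"
  where "toeplitz S P = (THE w. is_toeplitz_limit S P w)"

text \<open>
  Infinite words are indexed by positive integers, whereas \<open>!!\<close> counts from \<open>0\<close>.
\<close>

definition letter_at :: "'a stream \<Rightarrow> nat \<Rightarrow> 'a"
  where "letter_at w n = w !! (n - 1)"

definition arith_subseq :: "nat \<Rightarrow> nat \<Rightarrow> 'a stream \<Rightarrow> 'a stream"
  where "arith_subseq a b w = smap (\<lambda>n. letter_at w (a + b * (n - 1))) (fromN 1)"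

lemma letter_at_arith_subseq:
  "n \<ge> 1 \<Longrightarrow> letter_at (arith_subseq a b w) n = letter_at w (a + b * (n - 1))"
  by (simp add: letter_at_def arith_subseq_def)

text \<open>The limit exists and is unique, so the description in \<^const>\<open>toeplitz\<close> is proper.\<close>

lemma fill_agree:
  assumes "\<And>k. k < n \<Longrightarrow> isl (y !! k) \<and> y !! k = z !! k" and "k < n"
  shows "isl (fill S x y !! k) \<and> fill S x y !! k = fill S x z !! k"
  using assms
proof (induction n arbitrary: x y z k)
  case (Suc n)
  show ?case
  proof (cases "shd x")
    case (Inl a)
    have "isl (fill S (stl x) y !! l) \<and> fill S (stl x) y !! l = fill S (stl x) z !! l"
      if "l < n" for l
      by (rule Suc.IH[OF _ that]) (rule Suc.prems(1), simp)
    then show ?thesis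
      using Inl Suc.prems(2) by (cases k) (simp_all, metis)
  next
    case (Inr f)
    obtain b where b: "shd y = Inl b" "shd z = Inl b"
      using Suc.prems(1)[of 0] by (metis isl_def snth.simps(1) zero_less_Suc)
    have "isl (stl y !! k) \<and> stl y !! k = stl z !! k" if "k < n" for k
      using Suc.prems(1) that by (metis Suc_less_eq snth.simps(2))
    then have "isl (fill S (stl x) (stl y) !! l) \<and>
        fill S (stl x) (stl y) !! l = fill S (stl x) (stl z) !! l" if "l < n" for l
      using Suc.IH that by blast
    then show ?thesis
      using Inr b Suc.prems(2) by (cases k) (simp_all, metis)
  qed
qed simp

lemma toeplitz_approx_agree:
  assumes "starts_with_letter P" and "k < i"
  shows "isl (toeplitz_approx S P i !! k) \<and>
    toeplitz_approx S P (Suc i) !! k = toeplitz_approx S P i !! k"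
  using assms(2)
proof (induction i arbitrary: k)
  case (Suc i)
  obtain a where a: "shd (cycle P) = Inl a"
    using assms(1) by (auto simp: starts_with_letter_def isl_def)
  show ?case
  proof (cases k)
    case 0
    then show ?thesis using a by simp
  next
    case (Suc l)
    let ?x = "stl (cycle P)"
    have agree: "\<And>k. k < i \<Longrightarrow> isl (toeplitz_approx S P i !! k) \<and>
        toeplitz_approx S P i !! k = toeplitz_approx S P (Suc i) !! k"
      using Suc.IH by simp
    have "l < i" using Suc Suc.prems by simp
    with agree have step: "isl (fill S ?x (toeplitz_approx S P i) !! l) \<and>
        fill S ?x (toeplitz_approx S P i) !! l = fill S ?x (toeplitz_approx S P (Suc i)) !! l"
      by (rule fill_agree)
    have unfold: "toeplitz_approx S P (Suc j) !! k = fill S ?x (toeplitz_approx S P j) !! l" for j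
      using a Suc by simp
    show ?thesis
      using step unfold[of i] unfold[of "Suc i"] by metis
  qed
qed simp

lemma toeplitz_limit_ex1:
  assumes "starts_with_letter P"
  shows "\<exists>!w. is_toeplitz_limit S P w"
proof (rule ex_ex1I)
  let ?T = "toeplitz_approx S P"
  define w where "w = smap (\<lambda>n. projl (?T (Suc n) !! n)) nats"
  have stable: "?T i !! n = ?T (Suc n) !! n" if "i \<ge> Suc n" for i n
    using that
    by (induction i rule: dec_induct)
      (use toeplitz_approx_agree[OF assms] in \<open>simp_all del: toeplitz_approx.simps\<close>)
  have "?T i !! n = Inl (w !! n)" if "i \<ge> Suc n" for i n
    using stable[OF that] toeplitz_approx_agree[OF assms, of n "Suc n" S]
    by (simp add: w_def del: toeplitz_approx.simps)
  then show "\<exists>w. is_toeplitz_limit S P w"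
    unfolding is_toeplitz_limit_def eventually_sequentially by blast
next
  fix v w
  assume "is_toeplitz_limit S P v" "is_toeplitz_limit S P w"
  then have "v !! n = w !! n" for n
  proof -
    have "\<forall>\<^sub>F i in sequentially. toeplitz_approx S P i !! n = Inl (v !! n)"
      "\<forall>\<^sub>F i in sequentially. toeplitz_approx S P i !! n = Inl (w !! n)"
      using \<open>is_toeplitz_limit S P v\<close> \<open>is_toeplitz_limit S P w\<close>
      by (auto simp: is_toeplitz_limit_def)
    then obtain i where "toeplitz_approx S P i !! n = Inl (v !! n)"
      "toeplitz_approx S P i !! n = Inl (w !! n)"
      unfolding eventually_sequentially by (meson nle_le)
    then show ?thesis by (metis sum.inject(1))
  qed
  then show "v = w"
    using smap_alt[of id v w] by (simp add: stream.map_id)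
qed

end

theory Submission
  imports Defs "HOL-Number_Theory.Cong"
begin

text \<open>
  Let \<open>w\<close> be the Toeplitz word and \<open>f\<close> its gap at (zero-based) position \<open>c\<close>. Iterating
  \<open>w (c + r * k) = f (w k)\<close>, \<open>w\<close> has for every level \<open>m\<close> the period \<open>r ^ m\<close> off a single residue
  class, the holes of level \<open>m\<close>, on which it is a copy of \<open>w\<close> transformed by \<open>f ^^ m\<close>. The positions
  of the subsequence \<open>v n = w (a + b * n)\<close> that meet these holes are empty for some level, and \<open>v\<close>
  is periodic, or they form a single class \<open>d m + L m * k\<close> on which \<open>v\<close> is \<open>f ^^ m\<close> applied to
  \<open>w (y m + B m * k)\<close>. The pairs \<open>(y m, B m)\<close> are bounded, so two large levels \<open>t < m\<close> share
  one, and then \<open>v (d m + L m * k) = (f ^^ (m - t)) (v (d t + L t * k))\<close>. This is realised by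
  a pattern of length \<open>L m\<close> with \<open>L t\<close> gaps.
\<close>

section \<open>Letters of filled words\<close>

lemma num_gaps_simps [simp]:
  "num_gaps [] = 0"
  "num_gaps (s # P) = (if isl s then 0 else 1) + num_gaps P"
  "num_gaps (P @ P') = num_gaps P + num_gaps P'"
  by (simp_all add: num_gaps_def)

text \<open>Each gap consumes one symbol of \<open>y\<close>, so the gap at \<open>n\<close> meets
  the symbol whose index is the number of earlier gaps.\<close>

lemma fill_snth:
  "fill S x y !! n =
    (case x !! n of Inl a \<Rightarrow> Inl a | Inr f \<Rightarrow> fill_gap S f (y !! num_gaps (stake n x)))"
proof (induction n arbitrary: x y)
  case 0
  then show ?case by (simp split: sum.split)
next
  case (Suc n)
  then show ?case by (cases "shd x") (simp_all split: sum.split)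
qed

lemma cycle_snth:
  assumes "P \<noteq> []"
  shows "cycle P !! n = P ! (n mod length P)"
proof (induction n rule: less_induct)
  case (less n)
  show ?case
  proof (cases "n < length P")
    case True
    then show ?thesis
      using assms by (subst cycle_decomp) (simp_all add: shift_snth_less)
  next
    case False
    then have "n - length P < n" using assms by (cases P) auto
    have "cycle P !! n = cycle P !! (n - length P)"
      using False assms by (subst cycle_decomp) (simp_all add: shift_snth_ge)
    also have "\<dots> = P ! ((n - length P) mod length P)"
      using less[OF \<open>n - length P < n\<close>] .
    finally show ?thesis using False by (simp add: le_mod_geq)
  qed
qed

lemma num_gaps_stake_cycle:
  assumes "P \<noteq> []"
  shows "num_gaps (stake n (cycle P)) =
    num_gaps P * (n div length P) + num_gaps (take (n mod length P) P)"
proof (induction n rule: less_induct)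
  case (less n)
  show ?case
  proof (cases "n < length P")
    case True
    then show ?thesis
      using assms by (subst cycle_decomp) (simp_all add: stake_shift)
  next
    case False
    then have "n - length P < n" using assms by (cases P) auto
    have "stake n (cycle P) = P @ stake (n - length P) (cycle P)"
      using False assms by (subst cycle_decomp) (simp_all add: stake_shift)
    then show ?thesis using False assms less[OF \<open>n - length P < n\<close>]
      by (simp add: le_mod_geq le_div_geq)
  qed
qed

text \<open>The index of the letter that is filled into position \<open>n\<close>; junk if \<open>n\<close> is not a gap.\<close>
definition source_index :: "'a symb list \<Rightarrow> nat \<Rightarrow> nat"
  where "source_index P n =
    num_gaps P * (n div length P) + num_gaps (take (n mod length P) P)"

definition toeplitz_rec :: "'a symb list \<Rightarrow> (nat \<Rightarrow> 'a) \<Rightarrow> nat \<Rightarrow> 'a"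
  where "toeplitz_rec P v n =
    (case P ! (n mod length P) of Inl a \<Rightarrow> a | Inr f \<Rightarrow> f (v (source_index P n)))"

lemma fill_cycle_snth:
  assumes "P \<noteq> []"
  shows "fill S (cycle P) y !! n =
    (case P ! (n mod length P) of Inl a \<Rightarrow> Inl a
     | Inr f \<Rightarrow> fill_gap S f (y !! source_index P n))"
  using assms
  by (simp add: fill_snth cycle_snth num_gaps_stake_cycle source_index_def split: sum.split)

lemma num_gaps_le_length: "num_gaps P \<le> length P"
  by (simp add: num_gaps_def)

text \<open>Since the first symbol is a letter, at most \<open>n - 1\<close> gaps precede position
  \<open>n\<close>. This makes \<open>toeplitz_rec\<close> a well-founded recursion.\<close>

lemma source_index_less:
  assumes "starts_with_letter P" "\<not> isl (P ! (n mod length P))"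
  shows "source_index P n < n"
proof -
  have ne: "P \<noteq> []" using assms by (simp add: starts_with_letter_def)
  have "n \<noteq> 0"
    using assms by (metis mod_0 hd_conv_nth starts_with_letter_def)
  then obtain m where m: "n = Suc m" by (cases n) auto
  have "num_gaps (stake n (cycle P)) = num_gaps (stake m (stl (cycle P)))"
    using assms m by (simp add: starts_with_letter_def)
  also have "\<dots> \<le> m" using num_gaps_le_length[of "stake m (stl (cycle P))"] by simp
  finally show ?thesis
    using num_gaps_stake_cycle[OF ne, of n] m by (simp add: source_index_def)
qed

section \<open>Toeplitz words as solutions of a recursion\<close>

lemma toeplitz_limit:
  assumes "starts_with_letter P"
  shows "is_toeplitz_limit S P (toeplitz S P)"
  unfolding toeplitz_def by (rule theI'[OF toeplitz_limit_ex1[OF assms]])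

text \<open>Passage to the limit in the recursion of \<open>toeplitz_approx\<close>: for some
  \<open>i\<close>, position \<open>n\<close> at stage \<open>i + 1\<close> and its source at stage
  \<open>i\<close> have both reached their final letters.\<close>

lemma toeplitz_snth:
  assumes "starts_with_letter P"
  shows "toeplitz S P !! n = toeplitz_rec P ((!!) (toeplitz S P)) n"
proof -
  have ne: "P \<noteq> []" using assms by (simp add: starts_with_letter_def)
  let ?w = "toeplitz S P"
  have lim: "\<forall>\<^sub>F i in sequentially. toeplitz_approx S P i !! n = Inl (?w !! n)" for n
    using toeplitz_limit[OF assms] by (simp add: is_toeplitz_limit_def)
  have "\<forall>\<^sub>F i in sequentially. toeplitz_approx S P (Suc i) !! n = Inl (?w !! n)"
    using lim eventually_sequentially_Suc[of "\<lambda>i. toeplitz_approx S P i !! n = Inl (?w !! n)"]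
    by blast
  then have "\<forall>\<^sub>F i in sequentially. toeplitz_approx S P (Suc i) !! n = Inl (?w !! n) \<and>
      toeplitz_approx S P i !! source_index P n = Inl (?w !! source_index P n)"
    using lim eventually_conj by blast
  then obtain i where "toeplitz_approx S P (Suc i) !! n = Inl (?w !! n)"
      "toeplitz_approx S P i !! source_index P n = Inl (?w !! source_index P n)"
    unfolding eventually_sequentially by blast
  then show ?thesis
    by (auto simp: fill_cycle_snth[OF ne] toeplitz_rec_def split: sum.splits)
qed

text \<open>A well-founded recursion has only one solution. Sequences are identified with Toeplitz
  words by checking this recursion.\<close>

lemma toeplitz_eqI:
  assumes "starts_with_letter P" and "\<And>n. v n = toeplitz_rec P v n"
  shows "toeplitz S P !! n = v n"
proof (induction n rule: less_induct)
  case (less n)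
  then show ?case
    using source_index_less[OF assms(1), of n] assms(2)[of n]
    by (subst toeplitz_snth[OF assms(1)]) (auto simp: toeplitz_rec_def split: sum.splits)
qed

lemma toeplitz_in_alphabet:
  assumes "is_pattern S P" "starts_with_letter P"
  shows "toeplitz S P !! n \<in> S"
proof (induction n rule: less_induct)
  case (less n)
  have "P ! (n mod length P) \<in> symbols S"
    using assms(1) by (auto simp: is_pattern_def)
  then consider a where "P ! (n mod length P) = Inl a" "a \<in> S"
    | f where "P ! (n mod length P) = Inr f" "f \<in> Bij S"
    by (auto simp: symbols_def BijGroup_def)
  then show ?case
  proof cases
    case 1
    then show ?thesis by (simp add: toeplitz_snth[OF assms(2), of S n] toeplitz_rec_def)
  next
    case 2
    then have "toeplitz S P !! source_index P n \<in> S"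
      using less source_index_less[OF assms(2)] by simp
    moreover have "f ` S = S" using 2 by (simp add: Bij_def bij_betw_def)
    ultimately show ?thesis
      using 2 by (auto simp: toeplitz_snth[OF assms(2), of S n] toeplitz_rec_def)
  qed
qed

section \<open>Patterns for sequences periodic off one class\<close>

lemma restrict_transpose_Bij:
  assumes "x \<in> S" "y \<in> S"
  shows "restrict (Transposition.transpose x y) S \<in> Bij S"
proof -
  have "bij_betw (Transposition.transpose x y) S S"
    by (rule bij_betw_byWitness[where f' = "Transposition.transpose x y"])
      (use assms in \<open>auto simp: Transposition.transpose_def\<close>)
  then show ?thesis by (simp add: Bij_def)
qed

lemma take_map_upt: "i \<le> L \<Longrightarrow> take i (map h [0..<L]) = map h [0..<i]"
  by (simp add: take_map)

text \<open>The difference of minima is the size of the overlap of the prefix [0, n) with the gap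
  block [p, p + s).\<close>

lemma num_gaps_block:
  fixes h g :: "nat \<Rightarrow> _"
  shows "num_gaps (map (\<lambda>i. if p \<le> i \<and> i < p + s then Inr (h i) else Inl (g i)) [0..<n]) =
    min n (p + s) - min n p"
  by (induction n) auto

text \<open>
  In the pattern, only the gap at \<open>d\<close>, the \<open>j\<close>-th one, is filled with a nonconstant sequence of
  letters. The other \<open>s - 1\<close> gaps surround it so that it has the index \<open>j\<close>; each of them maps
  a constant to a constant.
\<close>
lemma toeplitz_of_two_scales:
  fixes v :: "nat \<Rightarrow> 'a"
  assumes v: "\<And>n. v n \<in> S" and g: "g \<in> Bij S"
    and ineqs: "j < s" "j < d" "d < L" "d + s \<le> L + j"
    and perL: "\<And>n. n mod L \<noteq> d \<Longrightarrow> v n = v (n mod L)"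
    and pers: "\<And>n. n mod s \<noteq> j \<Longrightarrow> v n = v (n mod s)"
    and gap: "\<And>k. v (d + L * k) = g (v (j + s * k))"
  shows "\<exists>Q. is_pattern S Q \<and> starts_with_letter Q \<and> (\<forall>n. v n = toeplitz S Q !! n)"
proof -
  \<comment> \<open>The block of \<open>s\<close> gaps starts at \<open>p\<close>, so that
    \<open>d\<close> is its gap number \<open>j\<close>, counted from 0. The inequalities keep the
    first symbol a letter (\<open>0 < p\<close>) and fit the block into the pattern
    (\<open>p + s \<le> L\<close>).\<close>
  define p where "p = d - j"
  define h where
    "h i = (if i = d then g else restrict (Transposition.transpose (v (i - p)) (v i)) S)" for i
  define q :: "nat \<Rightarrow> 'a symb" where
    "q i = (if p \<le> i \<and> i < p + s then Inr (h i) else Inl (v i))" for i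
  define Q where "Q = map q [0..<L]"
  have p: "0 < p" "p + j = d" "p + s \<le> L" using ineqs by (auto simp: p_def)
  have len: "length Q = L" by (simp add: Q_def)
  have "0 < L" using ineqs by simp
  have h: "h i \<in> Bij S" for i
    using g restrict_transpose_Bij[OF v v] by (simp add: h_def)
  have pat: "is_pattern S Q"
    using \<open>0 < L\<close> h v
    by (auto simp: is_pattern_def Q_def q_def symbols_def BijGroup_def)
  have start: "starts_with_letter Q"
    using \<open>0 < L\<close> p by (simp add: starts_with_letter_def Q_def hd_map q_def)
  have gaps: "num_gaps (take i Q) = min i (p + s) - min i p" if "i \<le> L" for i
    using num_gaps_block[where p = p and s = s and n = i and h = h and g = v]
    by (simp add: Q_def take_map_upt[OF that] q_def[abs_def])
  have all_gaps: "num_gaps Q = s"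
    using gaps[of L] p len by simp
  have "v n = toeplitz_rec Q v n" for n
  proof -
    define i k where "i = n mod L" and "k = n div L"
    have n: "n = i + L * k" and i: "i < L" using \<open>0 < L\<close> by (auto simp: i_def k_def)
    have nth: "Q ! (n mod length Q) = q i" using i by (simp add: len Q_def flip: i_def)
    show ?thesis
    proof (cases "p \<le> i \<and> i < p + s")
      case False
      then have "i \<noteq> d" using p ineqs by auto
      then have "v n = v i" using perL i_def by blast
      then show ?thesis using False by (auto simp: toeplitz_rec_def nth q_def)
    next
      case True
      have src: "source_index Q n = (i - p) + s * k"
        using True i gaps[of i] by (simp add: source_index_def len all_gaps flip: i_def k_def)
      have rec: "toeplitz_rec Q v n = h i (v ((i - p) + s * k))"
        using True by (simp add: toeplitz_rec_def nth q_def src)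
      show ?thesis
      proof (cases "i = d")
        case eq: True
        then have "i - p = j" using p by simp
        then show ?thesis using rec gap[of k] n eq by (simp add: h_def)
      next
        case neq: False
        have lt: "i - p < s" and "i - p \<noteq> j" using True p neq by auto
        \<comment> \<open>The source index is congruent to \<open>i - p\<close> modulo
          \<open>s\<close>, off the class of \<open>j\<close>, so its letter is independent of
          \<open>k\<close>; the transposition \<open>h i\<close> turns it into
          \<open>v i\<close>.\<close>
        then have "v ((i - p) + s * k) = v (i - p)"
          using pers[of "(i - p) + s * k"] by simp
        moreover have "v n = v i" using perL neq i_def by blast
        ultimately show ?thesis
          using rec neq v by (simp add: h_def)
      qed
    qed
  qed
  then have "toeplitz S Q !! n = v n" for n by (rule toeplitz_eqI[OF start])
  then show ?thesis using pat start by metis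
qed

lemma toeplitz_of_periodic:
  assumes "\<And>n. v n \<in> S" and "0 < L" and "\<And>n. v n = v (n mod L)"
  shows "\<exists>Q. is_pattern S Q \<and> starts_with_letter Q \<and> (\<forall>n. v n = toeplitz S Q !! n)"
proof -
  define Q :: "'a symb list" where "Q = map (\<lambda>i. Inl (v i)) [0..<L]"
  have start: "starts_with_letter Q"
    using assms(2) by (simp add: starts_with_letter_def Q_def hd_map)
  have "v n = toeplitz_rec Q v n" for n
    using assms(2,3) by (simp add: toeplitz_rec_def Q_def)
  then have "toeplitz S Q !! n = v n" for n by (rule toeplitz_eqI[OF start])
  moreover have "is_pattern S Q"
    using assms(1,2) by (auto simp: is_pattern_def Q_def symbols_def)
  ultimately show ?thesis using start by metis
qed

section \<open>Holes of a one-gap word and its arithmetic subsequences\<close>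

fun hole :: "nat \<Rightarrow> nat \<Rightarrow> nat \<Rightarrow> nat"
  where
    "hole r c 0 = 0"
  | "hole r c (Suc m) = c + r * hole r c m"

locale one_gap_word =
  fixes S :: "'a set" and w :: "nat \<Rightarrow> 'a" and f :: "'a \<Rightarrow> 'a" and r c :: nat
  assumes w_in: "w n \<in> S"
    and f_bij: "bij_betw f S S"
    and c_pos: "0 < c" and c_less: "c < r"
    and w_gap: "w (c + r * k) = f (w k)"
    and w_letter: "n mod r \<noteq> c \<Longrightarrow> w n = w (n mod r)"
begin

abbreviation "C \<equiv> hole r c"

text \<open>\<open>C m\<close> is the number whose \<open>m\<close> digits in base \<open>r\<close>
  all equal \<open>c\<close>.\<close>

lemma hole_less: "C m < r ^ m"
proof (induction m)
  case (Suc m)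
  then have "c + r * C m < r + r * C m" using c_less by simp
  also have "\<dots> \<le> r * r ^ m" using Suc mult_le_mono2[of "Suc (C m)" "r ^ m" r] by simp
  finally show ?case by simp
qed simp

lemma hole_strict_mono: "m < n \<Longrightarrow> C m < C n"
proof (rule lift_Suc_mono_less[of C])
  fix i
  have "C i \<le> r * C i" using c_less by simp
  then show "C i < C (Suc i)" using c_pos by (simp only: hole.simps)
qed

lemma le_hole: "m \<le> C m"
  by (induction m) (use hole_strict_mono[OF lessI] in \<open>auto intro: Suc_leI le_less_trans\<close>)

text \<open>One level up, the room above the hole grows by
  \<open>(r - 1) * (r ^ n - C n) - c\<close>, at least \<open>r - 1 - c \<ge> 0\<close>. This later
  leaves room in the pattern behind the gap at \<open>d m\<close>.\<close>

lemma hole_gap_mono: "m \<le> n \<Longrightarrow> int (r ^ m) - int (C m) \<le> int (r ^ n) - int (C n)"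
proof (induction n rule: dec_induct)
  case (step n)
  have "int r - 1 \<le> (int r - 1) * (int (r ^ n) - int (C n))"
  proof -
    have "1 \<le> int (r ^ n) - int (C n)" using hole_less[of n] by linarith
    then show ?thesis
      using mult_left_mono[of 1 "int (r ^ n) - int (C n)" "int r - 1"] c_less by simp
  qed
  then have "int c \<le> (int r - 1) * (int (r ^ n) - int (C n))"
    using c_less by linarith
  then have "int (r ^ n) - int (C n) \<le> int (r ^ Suc n) - int (C (Suc n))"
    by (simp add: algebra_simps)
  then show ?case using step by simp
qed simp

lemma w_hole: "w (C m + r ^ m * k) = (f ^^ m) (w k)"
proof (induction m)
  case (Suc m)
  have "w (C (Suc m) + r ^ Suc m * k) = w (c + r * (C m + r ^ m * k))"
    by (simp add: algebra_simps)
  then show ?case using Suc w_gap by simp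
qed simp

lemma w_periodic:
  assumes "n mod r ^ m \<noteq> C m"
  shows "w (n + r ^ m * k) = w n"
  using assms
proof (induction m arbitrary: n)
  case (Suc m)
  show ?case
  proof (cases "n mod r = c")
    case False
    then show ?thesis
      using w_letter[of n] w_letter[of "n + r ^ Suc m * k"] by (simp add: mult.assoc)
  next
    case True
    define l where "l = n div r"
    have n: "n = c + r * l" using True by (simp add: l_def flip: True)
    \<comment> \<open>Deleting the last digit \<open>c\<close> carries holes of level
      \<open>m + 1\<close> to holes of level \<open>m\<close>, so \<open>l\<close> avoids the
      latter.\<close>
    have "n mod r ^ Suc m = r * (l mod r ^ m) + c"
      using True by (simp add: mod_mult2_eq l_def)
    then have "l mod r ^ m \<noteq> C m" using Suc.prems by auto
    then have "w (l + r ^ m * k) = w l" by (rule Suc.IH)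
    moreover have "n + r ^ Suc m * k = c + r * (l + r ^ m * k)"
      using n by (simp add: algebra_simps)
    ultimately show ?thesis using w_gap n by metis
  qed
qed simp

text \<open>Hitting the holes is a linear congruence in \<open>n\<close>; its solutions form the
  single class \<open>d\<close> modulo \<open>r ^ m div q\<close>. The copy of \<open>w\<close> in
  the holes is first read at index \<open>y\<close>, whose bound prepares a pigeonhole
  argument.\<close>

lemma hole_of_level:
  assumes "b \<ge> 1" and "(a + b * n) mod r ^ m = C m" and "a < m"
  defines "q \<equiv> gcd b (r ^ m)"
  shows "\<exists>y d. y < b div q \<and> d < r ^ m div q \<and> a + b * d = C m + r ^ m * y \<and>
    (\<forall>n. n mod (r ^ m div q) \<noteq> d \<longrightarrow> w (a + b * n) = w (a + b * (n mod (r ^ m div q))))"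
proof -
  define L B where "L = r ^ m div q" and "B = b div q"
  have "r > 0" using c_less by simp
  then have q: "q > 0" "q dvd b" "q dvd r ^ m" using assms by (auto simp: q_def)
  have bL: "b * L = r ^ m * B" and rm: "r ^ m = q * L" and bq: "b = q * B"
    using q by (auto simp: L_def B_def)
  have "L > 0" using rm \<open>r > 0\<close> by (metis mult_is_0 not_gr_zero power_not_zero)
  define d where "d = n mod L"
  have nd: "n = d + L * (n div L)" by (simp add: d_def)
  have "a + b * n = (a + b * d) + r ^ m * (B * (n div L))"
    by (subst nd) (metis bL distrib_left group_cancel.add1 mult.assoc)
  then have hd: "(a + b * d) mod r ^ m = C m" using assms(2) by (metis mod_mult_self2)
  define y where "y = (a + b * d) div r ^ m"
  have y: "a + b * d = C m + r ^ m * y"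
    using hd by (metis mult_div_mod_eq add.commute y_def)
  have "d < L" using \<open>L > 0\<close> by (simp add: d_def)
  \<comment> \<open>Otherwise one period of the subsequence would already force
    \<open>C m \<le> a\<close>, against \<open>a < m \<le> C m\<close>.\<close>
  have "y < B"
  proof (rule ccontr)
    assume "\<not> y < B"
    then have "b * L \<le> r ^ m * y" using bL by simp
    moreover have "b * d \<le> b * L" using \<open>d < L\<close> by simp
    ultimately have "C m \<le> a" using y by linarith
    then show False using le_hole[of m] assms(3) by simp
  qed
  have per: "w (a + b * n') = w (a + b * (n' mod L))" if "n' mod L \<noteq> d" for n'
  proof -
    define k where "k = n' mod L"
    have n': "n' = k + L * (n' div L)" by (simp add: k_def)
    have "(a + b * k) mod r ^ m \<noteq> C m"
    proof
      assume "(a + b * k) mod r ^ m = C m"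
      then have "[a + b * k = a + b * d] (mod r ^ m)" using hd by (simp add: cong_def)
      then have "[b * k = b * d] (mod r ^ m)" by (simp add: cong_add_lcancel_nat)
      \<comment> \<open>Dividing by \<open>q\<close> leaves the factor \<open>B\<close>, which is
        invertible modulo \<open>L\<close>.\<close>
      then have "[q * (B * k) = q * (B * d)] (mod q * L)" by (metis bq rm mult.assoc)
      then have "[B * k = B * d] (mod L)"
        using q by (simp add: cong_def mult_mod_right [symmetric])
      moreover have "coprime B L"
        unfolding B_def L_def q_def using assms(1) by (intro div_gcd_coprime) auto
      ultimately have "[k = d] (mod L)" by (simp add: cong_mult_lcancel_nat)
      then show False
        using that \<open>d < L\<close> \<open>L > 0\<close> by (simp add: cong_def k_def)
    qed
    then have "w (a + b * k + r ^ m * (B * (n' div L))) = w (a + b * k)"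
      by (rule w_periodic)
    moreover have "a + b * n' = a + b * k + r ^ m * (B * (n' div L))"
      by (subst n') (metis bL distrib_left group_cancel.add1 mult.assoc)
    ultimately show ?thesis unfolding k_def by metis
  qed
  show ?thesis
    using \<open>y < B\<close> \<open>d < L\<close> y per unfolding L_def B_def by blast
qed

lemma arith_subseq_toeplitz:
  assumes "b \<ge> 1"
  shows "\<exists>Q. is_pattern S Q \<and> starts_with_letter Q \<and> (\<forall>n. w (a + b * n) = toeplitz S Q !! n)"
proof (cases "\<forall>m > a. \<exists>n. (a + b * n) mod r ^ m = C m")
  case False
  \<comment> \<open>All holes of some level are missed, so \<open>w_periodic\<close> applies at
    every position and \<open>r ^ m\<close> is a period.\<close>
  then obtain m where m: "\<And>n. (a + b * n) mod r ^ m \<noteq> C m" by blast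
  show ?thesis
  proof (rule toeplitz_of_periodic)
    show "0 < r ^ m" using c_less by simp
    fix n
    show "w (a + b * n) \<in> S" by (rule w_in)
    have "a + b * n = a + b * (n mod r ^ m) + r ^ m * (b * (n div r ^ m))"
      by (metis add.assoc add.commute distrib_left mod_mult_div_eq mult.left_commute)
    then show "w (a + b * n) = w (a + b * (n mod r ^ m))" using w_periodic m by metis
  qed
next
  case True
  define q where "q m = gcd b (r ^ m)" for m
  define L B where "L m = r ^ m div q m" and "B m = b div q m" for m
  have bL: "b * L m = r ^ m * B m" for m
    by (metis B_def L_def q_def div_mult_swap gcd_dvd1 gcd_dvd2 mult.commute)
  have "\<forall>m > a. \<exists>y d. y < B m \<and> d < L m \<and> a + b * d = C m + r ^ m * y \<and>
      (\<forall>n. n mod L m \<noteq> d \<longrightarrow> w (a + b * n) = w (a + b * (n mod L m)))"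
    using True hole_of_level[OF assms] unfolding B_def L_def q_def by blast
  then obtain y d where yd: "\<And>m. m > a \<Longrightarrow> y m < B m" "\<And>m. m > a \<Longrightarrow> d m < L m"
      "\<And>m. m > a \<Longrightarrow> a + b * d m = C m + r ^ m * y m"
      "\<And>m n. m > a \<Longrightarrow> n mod L m \<noteq> d m \<Longrightarrow> w (a + b * n) = w (a + b * (n mod L m))"
    by metis
  have "(\<lambda>m. (y m, B m)) ` {a<..} \<subseteq> {..b} \<times> {..b}"
    using yd(1) by (auto simp: B_def) (meson div_le_dividend le_trans less_imp_le)
  then have "finite ((\<lambda>m. (y m, B m)) ` {a<..})" by (rule finite_subset) simp
  then have "\<not> inj_on (\<lambda>m. (y m, B m)) {a<..}"
    using finite_imageD infinite_Ioi by blast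
  then obtain t m where tm: "a < t" "t < m" "y t = y m" "B t = B m"
    unfolding inj_on_def by (metis (no_types, lifting) greaterThan_iff nat_neq_iff prod.inject)
  then have "a < m" by simp
  have r_mono: "r ^ t \<le> r ^ m" using tm c_less by (simp add: power_increasing)
  have "d t < d m"
  proof -
    have "r ^ t * y t \<le> r ^ m * y m" using r_mono tm by simp
    then have "b * d t < b * d m"
      using yd(3)[of t] yd(3)[of m] tm hole_strict_mono[of t m] by linarith
    then show ?thesis by simp
  qed
  \<comment> \<open>With the shared \<open>y\<close> and \<open>B\<close>,
    \<open>b * (L i - d i)\<close> is \<open>r ^ i * (B - y) - C i + a\<close> for both levels. As
    \<open>B - y \<ge> 1\<close>, the comparison reduces to \<open>hole_gap_mono\<close>.\<close>
  have "d m + L t \<le> L m + d t"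
  proof -
    have "int (C m) - int (C t) \<le> 1 * (int (r ^ m) - int (r ^ t))"
      using hole_gap_mono[OF less_imp_le[OF tm(2)]] by (simp add: algebra_simps)
    moreover have "1 * (int (r ^ m) - int (r ^ t)) \<le> (int (B m) - int (y m)) * (int (r ^ m) - int (r ^ t))"
      using yd(1)[OF \<open>a < m\<close>] of_nat_mono[OF r_mono, where 'a = int]
      by (intro mult_right_mono) linarith+
    ultimately have
      "int (C m) - int (C t) \<le> (int (B m) - int (y m)) * (int (r ^ m) - int (r ^ t))"
      by (rule order.trans)
    moreover have "int (b * d m) = int (C m) + int (r ^ m) * int (y m) - int a"
      using arg_cong[OF yd(3)[OF \<open>a < m\<close>], of int] by simp
    moreover have "int (b * d t) = int (C t) + int (r ^ t) * int (y m) - int a"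
      using arg_cong[OF yd(3)[OF tm(1)], of int] tm(3) by simp
    moreover have "int (b * L m) = int (r ^ m) * int (B m)" "int (b * L t) = int (r ^ t) * int (B m)"
      using bL tm(4) by (metis of_nat_mult)+
    ultimately have "int (b * d m) + int (b * L t) \<le> int (b * L m) + int (b * d t)"
      by (simp only: left_diff_distrib right_diff_distrib) (simp add: mult.commute)
    then have "int (b * (d m + L t)) \<le> int (b * (L m + d t))" by (simp add: distrib_left)
    then have "b * (d m + L t) \<le> b * (L m + d t)" by (simp only: of_nat_le_iff)
    then show ?thesis using assms by simp
  qed
  define g where "g = restrict (f ^^ (m - t)) S"
  show ?thesis
  proof (rule toeplitz_of_two_scales)
    show "w (a + b * n) \<in> S" for n by (rule w_in)
    have "bij_betw (f ^^ (m - t)) S S" using f_bij by (rule bij_betw_funpow)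
    then show "g \<in> Bij S" by (auto simp: g_def Bij_def)
    show "d t < L t" "d t < d m" "d m < L m" "d m + L t \<le> L m + d t"
      using yd tm \<open>d t < d m\<close> \<open>d m + L t \<le> L m + d t\<close> by auto
    show "w (a + b * n) = w (a + b * (n mod L m))" if "n mod L m \<noteq> d m" for n
      using \<open>a < m\<close> that by (rule yd(4))
    show "w (a + b * n) = w (a + b * (n mod L t))" if "n mod L t \<noteq> d t" for n
      using tm(1) that by (rule yd(4))
    fix k
    \<comment> \<open>Levels \<open>t\<close> and \<open>m\<close> read the same letters of
      \<open>w\<close>, so their values differ exactly by \<open>f ^^ (m - t)\<close>.\<close>
    have val: "w (a + b * (d i + L i * k)) = (f ^^ i) (w (y m + B m * k))"
      if "i > a" "y i = y m" "B i = B m" for i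
    proof -
      have "a + b * (d i + L i * k) = (a + b * d i) + (b * L i) * k" by (simp add: algebra_simps)
      also have "\<dots> = C i + r ^ i * (y m + B m * k)"
        unfolding yd(3)[OF that(1)] bL that by (simp add: algebra_simps)
      finally show ?thesis using w_hole by metis
    qed
    have "(f ^^ m) x = (f ^^ (m - t)) ((f ^^ t) x)" for x
      using tm by (metis comp_apply funpow_add le_add_diff_inverse2 less_imp_le)
    then show "w (a + b * (d m + L m * k)) = g (w (a + b * (d t + L t * k)))"
      using val[OF \<open>a < m\<close> refl refl] val[OF tm(1,3,4)] w_in[of "a + b * (d t + L t * k)"]
      by (metis g_def restrict_apply')
  qed
qed

end

section \<open>From one-gap patterns to the theorem\<close>

lemma toeplitz_one_gap_word:
  assumes pat: "is_pattern S P" and start: "starts_with_letter P" and one: "num_gaps P = 1"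
  shows "\<exists>f c. one_gap_word S ((!!) (toeplitz S P)) f (length P) c"
proof -
  obtain u where "filter (\<lambda>s. \<not> isl s) P = [u]"
    using one by (auto simp: num_gaps_def length_Suc_conv)
  then obtain xs ys where P: "P = xs @ u # ys" and xs: "\<forall>s\<in>set xs. isl s" and u: "\<not> isl u"
      and ys: "filter (\<lambda>s. \<not> isl s) ys = []"
    by (auto simp: filter_eq_Cons_iff)
  obtain f where f: "u = Inr f" using u by (cases u) auto
  define c where "c = length xs"
  have nx: "num_gaps xs = 0" using xs by (simp add: num_gaps_def)
  have ny: "\<forall>s\<in>set ys. isl s" using ys by (simp add: filter_empty_conv)
  have c_less: "c < length P" by (simp add: P c_def)
  have c_pos: "0 < c" using start u by (cases xs) (auto simp: starts_with_letter_def P c_def)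
  have letter: "isl (P ! i)" if "i < length P" "i \<noteq> c" for i
  proof (cases "i < c")
    case True
    then show ?thesis using xs by (simp add: P nth_append c_def)
  next
    case False
    then have "P ! i = ys ! (i - Suc c)" "i - Suc c < length ys"
      using that by (auto simp: P nth_append c_def nth_Cons')
    then show ?thesis using ny by simp
  qed
  have "one_gap_word S ((!!) (toeplitz S P)) f (length P) c"
  proof
    show "toeplitz S P !! n \<in> S" for n by (rule toeplitz_in_alphabet[OF pat start])
    have "Inr f \<in> symbols S" using pat by (auto simp: is_pattern_def P f)
    then show "bij_betw f S S" by (auto simp: symbols_def BijGroup_def Bij_def)
    show "0 < c" "c < length P" by (rule c_pos c_less)+
    show "toeplitz S P !! (c + length P * k) = f (toeplitz S P !! k)" for k
    proof -
      \<comment> \<open>No gap precedes \<open>c\<close> and each period has one gap, so the source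
        of position \<open>c + length P * k\<close> is \<open>k\<close>.\<close>
      have "P ! c = Inr f" "num_gaps (take c P) = 0" using nx by (simp_all add: P c_def f)
      then show ?thesis
        using c_less one div_mult_self2[OF gr_implies_not0[OF c_less], of c k]
        by (subst toeplitz_snth[OF start]) (simp add: toeplitz_rec_def source_index_def)
    qed
    show "toeplitz S P !! n = toeplitz S P !! (n mod length P)" if "n mod length P \<noteq> c" for n
    proof -
      have "isl (P ! (n mod length P))" using letter[OF mod_less_divisor that] c_less by linarith
      then show ?thesis
        using toeplitz_snth[OF start, of S n] toeplitz_snth[OF start, of S "n mod length P"]
        by (auto simp: toeplitz_rec_def isl_def)
    qed
  qed
  then show ?thesis by blast
qed

theorem mainTheorem2:
  fixes G (structure) and P :: "'a symb list" and r a b :: nat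
  assumes "group G" and "cyclic_group G" and "finite (carrier G)"
    and "is_pattern (carrier G) P" and "starts_with_letter P"
    and "length P = r" and "num_gaps P = 1"
    and "a \<ge> 1" and "b \<ge> 1"
  shows "\<exists>Q. is_pattern (carrier G) Q \<and> starts_with_letter Q \<and>
    arith_subseq a b (toeplitz (carrier G) P) = toeplitz (carrier G) Q"
proof -
  let ?w = "toeplitz (carrier G) P"
  obtain f c where "one_gap_word (carrier G) ((!!) ?w) f (length P) c"
    using toeplitz_one_gap_word assms(4,5,7) by blast
  \<comment> \<open>Counting from 0 shifts the start of the progression to
    \<open>a - 1\<close>.\<close>
  then obtain Q where Q: "is_pattern (carrier G) Q" "starts_with_letter Q"
      "\<And>n. ?w !! (a - 1 + b * n) = toeplitz (carrier G) Q !! n"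
    using one_gap_word.arith_subseq_toeplitz[OF _ assms(9), where a = "a - 1"] by blast
  have "arith_subseq a b ?w !! n = toeplitz (carrier G) Q !! n" for n
    using Q(3)[of n] assms(8) by (simp add: arith_subseq_def letter_at_def)
  then have "arith_subseq a b ?w = toeplitz (carrier G) Q"
    using smap_alt[of id] by (metis id_apply stream.map_id)
  then show ?thesis using Q(1,2) by blast
qed

end
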